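(* Let $f:X\to Y$ and $g:Y\to Z$ be continuous maps and let $B\subseteq X$, so that $f:(X,B)\to(Y,f(B))$ and $g:(Y,f(B))\to(Z,gf(B))$ are maps of pairs. Then $$TC^S(gf,B)\le\min\{TC^S(f,B),\,TC^S(g,f(B))\}.$$
   Context: For a topological space $Y$, $PY=Y^I$ is the space of continuous paths $[0,1]\to Y$ with the compact-open topology, and for $C\subseteq Y$, $P_{Y\times C}=\{\gamma\in PY:\gamma(1)\in C\}$. For a continuous map $f:X\to Y$ and $B\subseteq X$, $TC^S(f,B)$ is the least integer $n\ge0$ such that $X\times B$ has an open cover $U_0,\dots,U_n$ with, for each $i$, a continuous map $\sigma_i:U_i\to P_{Y\times f(B)}$ satisfying $\sigma_i(x,b)(0)=f(x)$ and $\sigma_i(x,b)(1)=f(b)$; it is $\infty$ if there is no such cover. *)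

theory Defs
  imports "HOL-Analysis.Analysis" "HOL-Library.Extended_Nat"
begin

text \<open>
  Topological spaces are the abstract ones of type \<open>'a topology\<close>, so that arbitrary
  (in particular also empty) spaces are covered.

  A point of the mapping space is a continuous map on \<^term>\<open>topspace X\<close>; to make such a map
  unique as a HOL function, it is required to be \<^term>\<open>undefined\<close> outside \<^term>\<open>topspace X\<close>.
\<close>

definition mapping_space :: "'a topology \<Rightarrow> 'b topology \<Rightarrow> ('a \<Rightarrow> 'b) set" where
  "mapping_space X Y = {h. continuous_map X Y h \<and> h \<in> extensional (topspace X)}"

definition compact_open_topology :: "'a topology \<Rightarrow> 'b topology \<Rightarrow> ('a \<Rightarrow> 'b) topology" where
  "compact_open_topology X Y =
     topology_generated_by
       {{h \<in> mapping_space X Y. h ` K \<subseteq> V} | K V. compactin X K \<and> openin Y V}"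

text \<open>The set of subbasic opens contains the whole mapping space (take \<open>K\<close> empty).\<close>

lemma topspace_compact_open_topology:
  "topspace (compact_open_topology X Y) = mapping_space X Y"
proof -
  have "mapping_space X Y \<in>
      {{h \<in> mapping_space X Y. h ` K \<subseteq> V} | K V. compactin X K \<and> openin Y V}"
    by (rule CollectI, rule exI[of _ "{}"], rule exI[of _ "{}"]) auto
  then show ?thesis
    unfolding compact_open_topology_def topology_generated_by_topspace by blast
qed

definition path_space :: "'a topology \<Rightarrow> (real \<Rightarrow> 'a) topology" where
  "path_space Y = compact_open_topology (top_of_set {0..1}) Y"

definition path_space_ending_in :: "'a topology \<Rightarrow> 'a set \<Rightarrow> (real \<Rightarrow> 'a) topology" where
  "path_space_ending_in Y C = subtopology (path_space Y) {\<gamma>. \<gamma> 1 \<in> C}"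

text \<open>\<open>X \<times> B\<close> carries the product topology, \<open>B\<close> being a subspace of \<open>X\<close>.
  The sets \<open>U i\<close> need be neither distinct nor nonempty.\<close>

definition TCS_cover ::
  "'a topology \<Rightarrow> 'b topology \<Rightarrow> ('a \<Rightarrow> 'b) \<Rightarrow> 'a set \<Rightarrow> nat \<Rightarrow> (nat \<Rightarrow> ('a \<times> 'a) set) \<Rightarrow> bool"
where
  "TCS_cover X Y f B n U \<longleftrightarrow>
     (\<forall>i\<le>n. openin (prod_topology X (subtopology X B)) (U i)) \<and>
     (\<Union>i\<le>n. U i) = topspace X \<times> B \<and>
     (\<forall>i\<le>n. \<exists>\<sigma>.
        continuous_map (subtopology (prod_topology X (subtopology X B)) (U i))
          (path_space_ending_in Y (f ` B)) \<sigma> \<and>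
        (\<forall>(x, b) \<in> U i. \<sigma> (x, b) 0 = f x \<and> \<sigma> (x, b) 1 = f b))"

text \<open>The infimum over the empty set is \<open>\<infinity>\<close>; otherwise it is the least element.
  Only meaningful for \<^prop>\<open>B \<subseteq> topspace X\<close> and \<^prop>\<open>continuous_map X Y f\<close>.\<close>

definition TCS ::
  "'a topology \<Rightarrow> 'b topology \<Rightarrow> ('a \<Rightarrow> 'b) \<Rightarrow> 'a set \<Rightarrow> enat"
where
  "TCS X Y f B = Inf {enat n | n. \<exists>U. TCS_cover X Y f B n U}"

end

theory Submission
  imports Defs
begin

text \<open>
  A cover witnessing \<open>TC\<^sup>S(gf,B) \<le> n\<close> is built from a witness for either of the two
  factors, with the same number of sets.

  For \<open>f\<close>, keep the cover and push every path of \<open>Y\<close> forward along \<open>g\<close>. Since \<open>g\<close>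
  induces a continuous map on spaces of paths, the sections stay continuous, and the endpoints
  \<open>f x\<close>, \<open>f b\<close> become \<open>g (f x)\<close>, \<open>g (f b)\<close>.

  For \<open>g\<close>, a cover of \<open>Y \<times> f(B)\<close> is pulled back along \<open>f \<times> f : X \<times> B \<rightarrow> Y \<times> f(B)\<close>, and
  the sections are precomposed with this map. In both cases the paths end in
  \<open>g(f(B)) = (gf)(B)\<close>, as required.
\<close>

text \<open>
  The preimage of the subbasic set of maps sending \<open>K\<close> into \<open>V\<close> is the subbasic set of maps
  sending \<open>K\<close> into the preimage of \<open>V\<close>. The restriction selects the representative that is
  \<open>undefined\<close> outside the domain.
\<close>

lemma continuous_map_postcompose:
  assumes g: "continuous_map Y Z g"
  shows "continuous_map (compact_open_topology X Y) (compact_open_topology X Z)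
           (\<lambda>h. restrict (g \<circ> h) (topspace X))"
    (is "continuous_map _ _ ?G")
proof -
  have maps: "?G h \<in> mapping_space X Z" if "h \<in> mapping_space X Y" for h
  proof -
    have "continuous_map X Z (g \<circ> h)"
      using that g continuous_map_compose by (auto simp: mapping_space_def)
    then have "continuous_map X Z (?G h)"
      by (rule continuous_map_eq) simp
    then show ?thesis
      by (simp add: mapping_space_def)
  qed
  let ?S = "{{h \<in> mapping_space X Z. h ` K \<subseteq> V} | K V. compactin X K \<and> openin Z V}"
  have "continuous_map (compact_open_topology X Y) (topology_generated_by ?S) ?G"
  proof (rule continuous_on_generated_topo)
    fix W assume "W \<in> ?S"
    then obtain K V where K: "compactin X K" and V: "openin Z V"
      and W: "W = {h \<in> mapping_space X Z. h ` K \<subseteq> V}" by blast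
    let ?V' = "{y \<in> topspace Y. g y \<in> V}"
    have KX: "K \<subseteq> topspace X"
      using K by (rule compactin_subset_topspace)
    have "?G h ` K \<subseteq> V \<longleftrightarrow> h ` K \<subseteq> ?V'" if "h \<in> mapping_space X Y" for h
    proof -
      have "h ` K \<subseteq> topspace Y"
        using that KX by (auto simp: mapping_space_def continuous_map_def)
      then show ?thesis
        using KX by (auto simp: image_subset_iff subset_iff)
    qed
    then have "?G -` W \<inter> topspace (compact_open_topology X Y)
        = {h \<in> mapping_space X Y. h ` K \<subseteq> ?V'}"
      using maps unfolding W topspace_compact_open_topology by blast
    moreover have "openin Y ?V'"
      using g V by (rule openin_continuous_map_preimage)
    then have "openin (compact_open_topology X Y) {h \<in> mapping_space X Y. h ` K \<subseteq> ?V'}"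
      unfolding compact_open_topology_def
      using K by (intro topology_generated_by_Basis) blast
    ultimately show "openin (compact_open_topology X Y)
        (?G -` W \<inter> topspace (compact_open_topology X Y))"
      by simp
  next
    have "\<Union>?S = mapping_space X Z"
      using topspace_compact_open_topology[of X Z]
      unfolding compact_open_topology_def topology_generated_by_topspace .
    then show "?G ` topspace (compact_open_topology X Y) \<subseteq> \<Union>?S"
      using maps unfolding topspace_compact_open_topology by blast
  qed
  then show ?thesis
    unfolding compact_open_topology_def[of X Z] .
qed

lemma continuous_map_path_pushforward:
  assumes "continuous_map Y Z g"
  shows "continuous_map (path_space_ending_in Y C) (path_space_ending_in Z (g ` C))
           (\<lambda>\<gamma>. restrict (g \<circ> \<gamma>) {0..1})"
  using continuous_map_postcompose[OF assms, of "top_of_set {0..1::real}"]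
  unfolding path_space_ending_in_def path_space_def
  by (auto simp: continuous_map_in_subtopology intro: continuous_map_from_subtopology)

lemma TCS_cover_postcompose:
  assumes g: "continuous_map Y Z g" and U: "TCS_cover X Y f B n U"
  shows "TCS_cover X Z (g \<circ> f) B n U"
proof -
  let ?D = "\<lambda>i. subtopology (prod_topology X (subtopology X B)) (U i)"
  have "\<exists>\<sigma>. continuous_map (?D i) (path_space_ending_in Z ((g \<circ> f) ` B)) \<sigma> \<and>
          (\<forall>(x, b) \<in> U i. \<sigma> (x, b) 0 = (g \<circ> f) x \<and> \<sigma> (x, b) 1 = (g \<circ> f) b)"
    if i: "i \<le> n" for i
  proof -
    obtain \<sigma> where \<sigma>: "continuous_map (?D i) (path_space_ending_in Y (f ` B)) \<sigma>"
      and ends: "\<forall>(x, b) \<in> U i. \<sigma> (x, b) 0 = f x \<and> \<sigma> (x, b) 1 = f b"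
      using U i unfolding TCS_cover_def by meson
    let ?\<tau> = "(\<lambda>\<gamma>. restrict (g \<circ> \<gamma>) {0..1}) \<circ> \<sigma>"
    have "continuous_map (?D i) (path_space_ending_in Z ((g \<circ> f) ` B)) ?\<tau>"
      using continuous_map_compose[OF \<sigma> continuous_map_path_pushforward[OF g]]
      by (simp only: image_comp)
    moreover have "\<forall>(x, b) \<in> U i. ?\<tau> (x, b) 0 = (g \<circ> f) x \<and> ?\<tau> (x, b) 1 = (g \<circ> f) b"
      using ends by auto
    ultimately show ?thesis by blast
  qed
  then show ?thesis
    using U unfolding TCS_cover_def by blast
qed

lemma TCS_cover_pullback:
  assumes f: "continuous_map X Y f" and B: "B \<subseteq> topspace X"
    and U: "TCS_cover Y Z g (f ` B) n U"
  shows "TCS_cover X Z (g \<circ> f) B n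
           (\<lambda>i. {p \<in> topspace X \<times> B. map_prod f f p \<in> U i})"
    (is "TCS_cover X Z _ B n ?V")
proof -
  let ?P = "prod_topology X (subtopology X B)"
  let ?Q = "prod_topology Y (subtopology Y (f ` B))"
  have topP: "topspace ?P = topspace X \<times> B"
    using B by auto
  have "continuous_map (subtopology X B) (subtopology Y (f ` B)) f"
    using f by (auto simp: continuous_map_in_subtopology intro: continuous_map_from_subtopology)
  then have F: "continuous_map ?P ?Q (map_prod f f)"
    using f unfolding map_prod_def
    by (auto simp: continuous_map_prod_top)
  have "openin ?P (?V i)" if "i \<le> n" for i
    using openin_continuous_map_preimage[OF F, of "U i"] U that
    unfolding TCS_cover_def topP by blast
  moreover have "(\<Union>i\<le>n. ?V i) = topspace X \<times> B"
  proof -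
    have "map_prod f f p \<in> (\<Union>i\<le>n. U i)" if "p \<in> topspace X \<times> B" for p
    proof -
      have "map_prod f f p \<in> topspace Y \<times> f ` B"
        using that f by (auto simp: continuous_map_def)
      then show ?thesis
        using U unfolding TCS_cover_def by simp
    qed
    then show ?thesis by blast
  qed
  moreover have "\<exists>\<sigma>. continuous_map (subtopology ?P (?V i))
            (path_space_ending_in Z ((g \<circ> f) ` B)) \<sigma> \<and>
          (\<forall>(x, b) \<in> ?V i. \<sigma> (x, b) 0 = (g \<circ> f) x \<and> \<sigma> (x, b) 1 = (g \<circ> f) b)"
    if i: "i \<le> n" for i
  proof -
    obtain \<sigma> where \<sigma>: "continuous_map (subtopology ?Q (U i))
          (path_space_ending_in Z (g ` f ` B)) \<sigma>"
      and ends: "\<forall>(y, c) \<in> U i. \<sigma> (y, c) 0 = g y \<and> \<sigma> (y, c) 1 = g c"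
      using U i unfolding TCS_cover_def by meson
    have "continuous_map (subtopology ?P (?V i)) (subtopology ?Q (U i)) (map_prod f f)"
      using F by (auto simp: continuous_map_in_subtopology intro: continuous_map_from_subtopology)
    then have "continuous_map (subtopology ?P (?V i))
        (path_space_ending_in Z ((g \<circ> f) ` B)) (\<sigma> \<circ> map_prod f f)"
      using continuous_map_compose \<sigma> unfolding image_comp by blast
    moreover have "\<forall>(x, b) \<in> ?V i. (\<sigma> \<circ> map_prod f f) (x, b) 0 = (g \<circ> f) x \<and>
        (\<sigma> \<circ> map_prod f f) (x, b) 1 = (g \<circ> f) b"
      using ends by auto
    ultimately show ?thesis by blast
  qed
  ultimately show ?thesis
    unfolding TCS_cover_def by blast
qed

lemma TCS_mono_covers:
  assumes "\<And>n U. TCS_cover X Y f B n U \<Longrightarrow> \<exists>V. TCS_cover X' Y' f' B' n V"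
  shows "TCS X' Y' f' B' \<le> TCS X Y f B"
  unfolding TCS_def using assms by (intro Inf_superset_mono) blast

theorem proposition5p6:
  fixes X :: "'a topology" and Y :: "'b topology" and Z :: "'c topology"
    and f :: "'a \<Rightarrow> 'b" and g :: "'b \<Rightarrow> 'c" and B :: "'a set"
  assumes "continuous_map X Y f"
    and "continuous_map Y Z g"
    and "B \<subseteq> topspace X"
  shows "TCS X Z (g \<circ> f) B \<le> min (TCS X Y f B) (TCS Y Z g (f ` B))"
proof (rule min.boundedI)
  show "TCS X Z (g \<circ> f) B \<le> TCS X Y f B"
    using TCS_cover_postcompose[OF assms(2)] by (intro TCS_mono_covers) blast
  show "TCS X Z (g \<circ> f) B \<le> TCS Y Z g (f ` B)"
    using TCS_cover_pullback[OF assms(1,3)] by (intro TCS_mono_covers) blast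
qed

end
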